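(* Let $n\ge 1$. Let $(k_j)_{j\ge0}$ and $(\ell_j)_{j\ge0}$ be base sequences. Let $M=(M_j)_{j\ge0}$ be a weight sequence with moderate growth. Assume that $m_{k_{j+1}}/m_{k_j}$ and $m_{\ell_{j+1}}/m_{\ell_j}$ are bounded in $j$, where $m_j := M_j^{1/j}$. Then: (a) $\mathcal{S}^{\{M\}}_{(k_j),(\ell_j)}(\mathbb{R}^n) = \mathcal{S}^{\{M\}}(\mathbb{R}^n)$ provided that $j/m_j$ is bounded. (b) $\mathcal{S}^{(M)}_{(k_j),(\ell_j)}(\mathbb{R}^n) = \mathcal{S}^{(M)}(\mathbb{R}^n)$ provided that $j/m_j \to 0$ as $j\to\infty$.
   Context: A base sequence is a strictly increasing infinite sequence $0 = k_0 < k_1 < k_2 < \cdots$ of integers. A weight sequence is a positive sequence $M=(M_k)_{k\ge 0}$ with $M_0=1\le M_1 \le \mu_2 \le \mu_3 \le \cdots$, where $\mu_k:= M_k/M_{k-1}$. We put $m_k:= M_k^{1/k}$ for $k\ge 1$ and $m_0:=1$ (so that $(\rho m_k)^k=\rho^k M_k$ for all $k \ge 0$). $M$ has moderate growth if $\sup_{j,k\ge1} \big(\frac{M_{j+k}}{M_jM_k}\big)^{1/(j+k)} <\infty$. $\mathcal{S}^{\{M\}}(\mathbb{R}^n)$ (resp. $\mathcal{S}^{(M)}(\mathbb{R}^n)$) is the set of all $f \in C^\infty(\mathbb{R}^n)$ such that there exist $\rho,\sigma>0$ such that (resp. for all $\rho,\sigma>0$) $$\sup_{\alpha,\beta \in \mathbb{N}^n}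 \sup_{x \in \mathbb{R}^n} \frac{|x^\alpha \partial^\beta f(x)|}{(\rho m_{|\alpha|})^{|\alpha|} (\sigma m_{|\beta|})^{|\beta|}} < \infty.$$ $\mathcal{S}^{\{M\}}_{(k_j),(\ell_j)}(\mathbb{R}^n)$ (resp. $\mathcal{S}^{(M)}_{(k_j),(\ell_j)}(\mathbb{R}^n)$) is the set of all $f \in C^\infty(\mathbb{R}^n)$ such that there exist $C,\rho,\sigma>0$ (resp. for all $\rho,\sigma>0$ there is $C>0$) such that for all $j \ge 0$ $$\max_{|\alpha|=k_j} \sup_{x\in\mathbb{R}^n} |x^\alpha f(x)| \le C (\rho m_{k_j})^{k_j}\quad \text{ and } \quad \max_{|\beta|=\ell_j}\sup_{x\in\mathbb{R}^n} |\partial^\beta f(x)| \le C (\sigma m_{\ell_j})^{\ell_j}.$$ *)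

theory Defs
  imports "HOL-Analysis.Analysis"
begin

definition base_sequence :: "(nat \<Rightarrow> nat) \<Rightarrow> bool" where
  "base_sequence k \<longleftrightarrow> k 0 = 0 \<and> strict_mono k"

definition quot_seq :: "(nat \<Rightarrow> real) \<Rightarrow> nat \<Rightarrow> real" where
  "quot_seq M k = M k / M (k - 1)"

definition root_seq :: "(nat \<Rightarrow> real) \<Rightarrow> nat \<Rightarrow> real" where
  "root_seq M k = (if k = 0 then 1 else root k (M k))"

text \<open>Since \<open>M 0 = 1\<close>, the first quotient is \<open>quot_seq M 1 = M 1\<close>.\<close>

definition weight_sequence :: "(nat \<Rightarrow> real) \<Rightarrow> bool" where
  "weight_sequence M \<longleftrightarrow>
     (\<forall>k. M k > 0) \<and> M 0 = 1 \<and> 1 \<le> M 1 \<and>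
     (\<forall>k\<ge>1. quot_seq M k \<le> quot_seq M (k + 1))"

definition moderate_growth :: "(nat \<Rightarrow> real) \<Rightarrow> bool" where
  "moderate_growth M \<longleftrightarrow>
     bdd_above {root (j + k) (M (j + k) / (M j * M k)) | j k. j \<ge> 1 \<and> k \<ge> 1}"

type_synonym 'n multiindex = "'n \<Rightarrow> nat"

definition mi_size :: "'n::finite multiindex \<Rightarrow> nat" where
  "mi_size \<alpha> = (\<Sum>i\<in>UNIV. \<alpha> i)"

definition mi_power :: "real ^ 'n::finite \<Rightarrow> 'n multiindex \<Rightarrow> real" where
  "mi_power x \<alpha> = (\<Prod>i\<in>UNIV. (x $ i) ^ \<alpha> i)"

definition partial :: "'n::finite \<Rightarrow> (real ^ 'n \<Rightarrow> complex) \<Rightarrow> real ^ 'n \<Rightarrow> complex" where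
  "partial i f x = vector_derivative (\<lambda>t. f (x + t *\<^sub>R axis i 1)) (at 0)"

primrec C_k :: "nat \<Rightarrow> (real ^ 'n::finite \<Rightarrow> complex) \<Rightarrow> bool" where
  "C_k 0 f \<longleftrightarrow> continuous_on UNIV f"
| "C_k (Suc k) f \<longleftrightarrow> f differentiable_on UNIV \<and> (\<forall>i. C_k k (partial i f))"

definition smooth :: "(real ^ 'n::finite \<Rightarrow> complex) \<Rightarrow> bool" where
  "smooth f \<longleftrightarrow> (\<forall>k. C_k k f)"

text \<open>The index type carries no order, so an arbitrary enumeration of the coordinates
  fixes the order of differentiation in \<open>mi_deriv\<close>. By symmetry of mixed partial derivatives
  the choice is immaterial for smooth functions, the only ones to which \<open>mi_deriv\<close> is applied.\<close>

definition coords :: "'n::finite list" where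
  "coords = (SOME is. distinct is \<and> set is = UNIV)"

lemma coords: "distinct (coords :: 'n::finite list)" "set (coords :: 'n list) = UNIV"
proof -
  have "\<exists>is :: 'n list. distinct is \<and> set is = UNIV"
    using finite_distinct_list[of "UNIV :: 'n set"] by auto
  from someI_ex[OF this] show "distinct (coords :: 'n list)" "set (coords :: 'n list) = UNIV"
    by (simp_all add: coords_def)
qed

definition mi_deriv ::
  "'n::finite multiindex \<Rightarrow> (real ^ 'n \<Rightarrow> complex) \<Rightarrow> real ^ 'n \<Rightarrow> complex" where
  "mi_deriv \<beta> f = foldr (\<lambda>i. partial i ^^ \<beta> i) coords f"

text \<open>In each pair below, the suffixes \<open>Roumieu\<close> and \<open>Beurling\<close> stand for the classes written
  with \<open>{M}\<close> (some \<open>\<rho>, \<sigma>\<close>) and \<open>(M)\<close> (all \<open>\<rho>, \<sigma>\<close>), respectively.\<close>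

definition GS_bound ::
  "(nat \<Rightarrow> real) \<Rightarrow> real \<Rightarrow> real \<Rightarrow> (real ^ 'n::finite \<Rightarrow> complex) \<Rightarrow> bool" where
  "GS_bound M \<rho> \<sigma> f \<longleftrightarrow>
     bdd_above (range (\<lambda>(\<alpha>, \<beta>, x).
       norm (mi_power x \<alpha> *\<^sub>R mi_deriv \<beta> f x) /
       ((\<rho> * root_seq M (mi_size \<alpha>)) ^ mi_size \<alpha> * (\<sigma> * root_seq M (mi_size \<beta>)) ^ mi_size \<beta>)))"

definition GS_Roumieu :: "(nat \<Rightarrow> real) \<Rightarrow> (real ^ 'n::finite \<Rightarrow> complex) set" where
  "GS_Roumieu M = {f. smooth f \<and> (\<exists>\<rho>>0. \<exists>\<sigma>>0. GS_bound M \<rho> \<sigma> f)}"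

definition GS_Beurling :: "(nat \<Rightarrow> real) \<Rightarrow> (real ^ 'n::finite \<Rightarrow> complex) set" where
  "GS_Beurling M = {f. smooth f \<and> (\<forall>\<rho>>0. \<forall>\<sigma>>0. GS_bound M \<rho> \<sigma> f)}"

text \<open>The bounds on \<open>max\<close> and \<open>sup\<close> are written pointwise, as \<open>Sup\<close> on the reals is
  unspecified for unbounded sets.\<close>

definition lacunary_bound ::
  "(nat \<Rightarrow> real) \<Rightarrow> (nat \<Rightarrow> nat) \<Rightarrow> (nat \<Rightarrow> nat) \<Rightarrow> real \<Rightarrow> real \<Rightarrow> real \<Rightarrow>
     (real ^ 'n::finite \<Rightarrow> complex) \<Rightarrow> bool" where
  "lacunary_bound M k l C \<rho> \<sigma> f \<longleftrightarrow>
     (\<forall>j. (\<forall>\<alpha>. mi_size \<alpha> = k j \<longrightarrow>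
            (\<forall>x. norm (mi_power x \<alpha> *\<^sub>R f x) \<le> C * (\<rho> * root_seq M (k j)) ^ k j)) \<and>
          (\<forall>\<beta>. mi_size \<beta> = l j \<longrightarrow>
            (\<forall>x. norm (mi_deriv \<beta> f x) \<le> C * (\<sigma> * root_seq M (l j)) ^ l j)))"

definition lacunary_GS_Roumieu ::
  "(nat \<Rightarrow> real) \<Rightarrow> (nat \<Rightarrow> nat) \<Rightarrow> (nat \<Rightarrow> nat) \<Rightarrow> (real ^ 'n::finite \<Rightarrow> complex) set" where
  "lacunary_GS_Roumieu M k l =
     {f. smooth f \<and> (\<exists>C>0. \<exists>\<rho>>0. \<exists>\<sigma>>0. lacunary_bound M k l C \<rho> \<sigma> f)}"

definition lacunary_GS_Beurling ::
  "(nat \<Rightarrow> real) \<Rightarrow> (nat \<Rightarrow> nat) \<Rightarrow> (nat \<Rightarrow> nat) \<Rightarrow> (real ^ 'n::finite \<Rightarrow> complex) set" where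
  "lacunary_GS_Beurling M k l =
     {f. smooth f \<and> (\<forall>\<rho>>0. \<forall>\<sigma>>0. \<exists>C>0. lacunary_bound M k l C \<rho> \<sigma> f)}"

end

theory Submission
  imports Defs "HOL-Complex_Analysis.Conformal_Mappings"
begin

text \<open>
  Each inclusion of \<open>GS\<close> classes in lacunary classes only takes one of the multiindices to be zero.
  For the converse, all mixed products \<open>x ^ \<alpha> * \<partial> ^ \<beta> f\<close> have to be estimated from
  separate bounds on \<open>x ^ \<alpha> * f\<close> and \<open>\<partial> ^ \<beta> f\<close>, known for sparse orders only.

  The main tool is a local Kolmogorov inequality: if \<open>f\<close> is bounded by \<open>\<epsilon> \<le> C\<close> on a cube around
  \<open>x\<close> whose size is a suitable multiple of \<open>N / R\<close>, and its derivatives of order \<open>N\<close> are bounded by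
  \<open>C * R ^ N\<close> everywhere, then derivatives of order \<open>b \<le> N / 2\<close> at \<open>x\<close> are bounded by a constant times
  \<open>sqrt (\<epsilon> * C) * (exp 3 * R) ^ b\<close>, uniformly in \<open>N\<close> (\<open>mi_deriv_interpolation\<close>). In one variable
  this is proved by comparing \<open>f\<close> with its Taylor polynomial of degree less than \<open>N\<close> and
  estimating the coefficients of a polynomial bounded on an interval by a Bernstein--Walsh
  argument (\<open>derivative_bound_at_centre\<close>). Uniformity in \<open>N\<close> is essential, because the
  gaps of the base sequences may be huge.

  For orders \<open>a\<close> and \<open>b\<close>, let \<open>N\<close> be the first base index beyond \<open>2 * b\<close> and \<open>R = \<sigma> * root_seq M N\<close>.
  The hypotheses on the ratios and on moderate growth make \<open>root_seq M N\<close> comparable to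
  \<open>root_seq M b\<close>, and boundedness of \<open>j / root_seq M j\<close> makes the size \<open>H\<close> of the cubes
  a constant. At distance at least \<open>2 * H\<close> from the origin \<open>f\<close> is bounded on the cube around \<open>x\<close> by its
  decay of order \<open>2 * a\<close>; the square root leaves precisely decay of order \<open>a\<close>. At smaller
  distances \<open>(2 * H) ^ a\<close> is absorbed by \<open>M a\<close>, which grows at least like \<open>fact a\<close> up to
  exponential factors. All this changes \<open>\<rho>\<close> and \<open>\<sigma>\<close> by fixed factors only, hence it applies to
  the Roumieu and the Beurling classes alike (\<open>lacunary_bound_imp_GS_bound\<close>).
\<close>

(* Below, the dollar sign is reserved for the components of a vector. *)
no_notation fps_nth (infixl \<open>$\<close> 75)

section \<open>A Kolmogorov inequality in one variable\<close>

text \<open>A Bernstein--Walsh inequality. The Joukowski substitution \<open>z = (w + 1/w) / 2\<close> maps the unit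
  circle onto \<open>[-1, 1]\<close>, and multiplying by \<open>w ^ n\<close> clears the pole at \<open>0\<close>. The maximum
  principle on the unit disc carries the bound from the circle to the inside, and every \<open>z\<close> has a
  preimage \<open>w\<close> in the disc for which \<open>1/w\<close> has norm at most \<open>1 + 2 * norm z\<close>.\<close>

lemma polynomial_growth_off_interval:
  fixes c :: "nat \<Rightarrow> complex"
  assumes bound: "\<And>t::real. \<bar>t\<bar> \<le> 1 \<Longrightarrow> norm (\<Sum>m\<le>n. c m * of_real t ^ m) \<le> B"
  shows "norm (\<Sum>m\<le>n. c m * z ^ m) \<le> B * (1 + 2 * norm z) ^ n"
proof -
  define Q where "Q w = (\<Sum>m\<le>n. c m * ((w\<^sup>2 + 1) / 2) ^ m * w ^ (n - m))" for w :: complex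
  have Q_eq: "Q w = w ^ n * (\<Sum>m\<le>n. c m * v ^ m)" if "(w\<^sup>2 + 1) / 2 = w * v" for w v
  proof -
    have *: "c m * (w * v) ^ m * w ^ (n - m) = w ^ n * (c m * v ^ m)" if "m \<le> n" for m
      using that by (simp add: power_mult_distrib mult_ac power_add [symmetric])
    show ?thesis
      unfolding Q_def that sum_distrib_left by (intro sum.cong refl *) simp
  qed
  have Q_bound: "norm (Q w) \<le> B" if "norm w \<le> 1" for w
  proof (rule maximum_modulus_frontier [where S = "cball 0 1" and f = Q and \<xi> = w])
    show "Q holomorphic_on interior (cball 0 1)" "continuous_on (closure (cball 0 1)) Q"
      unfolding Q_def by (auto intro!: holomorphic_intros continuous_intros)
    show "w \<in> cball 0 1"
      using that by simp
  next
    fix u :: complex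
    assume "u \<in> frontier (cball 0 1)"
    then have u: "norm u = 1"
      by simp
    then have "u * cnj u = 1"
      by (simp add: complex_norm_square [symmetric])
    \<comment> \<open>On the unit circle \<open>1/u\<close> is the conjugate of \<open>u\<close>, so \<open>(u + 1/u) / 2 = Re u\<close> lies in \<open>[-1, 1]\<close>.\<close>
    then have "(u\<^sup>2 + 1) / 2 = u * of_real (Re u)"
      by (simp add: power2_eq_square complex_eq_iff)
    from Q_eq [OF this] have "norm (Q u) = norm (\<Sum>m\<le>n. c m * of_real (Re u) ^ m)"
      by (simp add: norm_mult norm_power u)
    also have "\<dots> \<le> B"
      using abs_Re_le_cmod [of u] u by (intro bound) simp
    finally show "norm (Q u) \<le> B" .
  qed auto
  \<comment> \<open>The two preimages of \<open>z\<close> are \<open>z - r\<close> and \<open>z + r\<close>; their product is \<open>1\<close>, so one of them is in the disc.\<close>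
  define r where "r = csqrt (z\<^sup>2 - 1)"
  have r2: "r\<^sup>2 = z\<^sup>2 - 1"
    by (simp add: r_def)
  have "(norm r)\<^sup>2 \<le> (norm z)\<^sup>2 + 1"
    using norm_triangle_ineq4 [of "z\<^sup>2" 1] by (simp add: r2 norm_power [symmetric])
  also have "\<dots> \<le> (norm z + 1)\<^sup>2"
    by (simp add: power2_eq_square algebra_simps)
  finally have r_le: "norm r \<le> norm z + 1"
    by (rule power2_le_imp_le) simp
  have prod: "(z - r) * (z + r) = 1"
    using r2 by (simp add: algebra_simps power2_eq_square)
  have "norm (z - r) * norm (z + r) = 1"
    using prod by (metis norm_mult norm_one)
  then have "norm (z - r) \<le> 1 \<or> norm (z + r) \<le> 1"
    by (smt (verit) mult_less_cancel_left2 mult_le_cancel_left1)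
  then obtain w v where wv: "norm w \<le> 1" "w * v = 1" "w + v = 2 * z" "norm v \<le> 1 + 2 * norm z"
  proof
    assume "norm (z - r) \<le> 1"
    then show thesis
      using prod r_le norm_triangle_ineq [of z r] by (intro that [of "z - r" "z + r"]) auto
  next
    assume "norm (z + r) \<le> 1"
    then show thesis
      using prod r_le norm_triangle_ineq4 [of z r]
      by (intro that [of "z + r" "z - r"]) (auto simp: mult.commute)
  qed
  have "(w\<^sup>2 + 1) / 2 = w * ((w + v) / 2)"
    using wv(2) by (simp add: power2_eq_square algebra_simps)
  then have eq: "(w\<^sup>2 + 1) / 2 = w * z"
    using wv(3) by simp
  have "norm (\<Sum>m\<le>n. c m * z ^ m) = norm (v ^ n * Q w)"
    unfolding Q_eq [OF eq] using wv(2)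
    by (simp add: mult.assoc [symmetric] power_mult_distrib [symmetric] mult.commute)
  also have "\<dots> \<le> (1 + 2 * norm z) ^ n * B"
    using wv(1,4) Q_bound [of w]
    by (auto simp: norm_mult norm_power intro!: mult_mono power_mono)
  finally show ?thesis
    by (simp add: mult.commute)
qed

text \<open>Cauchy's inequality on the circle of radius \<open>s\<close>. The radius is left free because the choice
  \<open>s = r / n\<close> is what gives a bound of size \<open>(n * exp 2 / r) ^ r\<close> instead of one that is
  exponential in \<open>n\<close> even for small \<open>r\<close>.\<close>

lemma polynomial_coefficient_bound:
  fixes c :: "nat \<Rightarrow> real"
  assumes bound: "\<And>t. \<bar>t\<bar> \<le> 1 \<Longrightarrow> \<bar>\<Sum>m\<le>n. c m * t ^ m\<bar> \<le> B"
    and "r \<le> n" and "0 < s"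
  shows "\<bar>c r\<bar> \<le> B * (1 + 2 * s) ^ n / s ^ r"
proof -
  define p where "p z = (\<Sum>m\<le>n. complex_of_real (c m) * z ^ m)" for z
  have p_real: "norm (p (of_real t)) \<le> B" if "\<bar>t\<bar> \<le> 1" for t
  proof -
    have "p (of_real t) = of_real (\<Sum>m\<le>n. c m * t ^ m)"
      by (simp add: p_def)
    then show ?thesis
      using bound [OF that] by (simp only: norm_of_real)
  qed
  have p_le: "norm (p z) \<le> B * (1 + 2 * norm z) ^ n" for z
    unfolding p_def using p_real by (intro polynomial_growth_off_interval) (simp add: p_def)
  have "p has_fps_expansion (\<Sum>m\<le>n. fps_const (of_real (c m)) * fps_X ^ m)"
    unfolding p_def by (intro fps_expansion_intros)
  then have "fps_nth (\<Sum>m\<le>n. fps_const (of_real (c m)) * fps_X ^ m) r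
      = (deriv ^^ r) p 0 / fact r"
    by (rule fps_nth_fps_expansion)
  moreover have "fps_nth (\<Sum>m\<le>n. fps_const (complex_of_real (c m)) * fps_X ^ m) r = of_real (c r)"
    using \<open>r \<le> n\<close> by (simp add: fps_sum_nth fps_X_power_nth if_distrib sum.delta cong: if_cong)
  ultimately have "(deriv ^^ r) p 0 = fact r * of_real (c r)"
    by (simp add: field_simps)
  moreover have "norm ((deriv ^^ r) p 0) \<le> fact r * (B * (1 + 2 * s) ^ n) / s ^ r"
  proof (rule Cauchy_inequality)
    show "p holomorphic_on ball 0 s" "continuous_on (cball 0 s) p"
      unfolding p_def by (auto intro!: holomorphic_intros continuous_intros)
    show "norm (p z) \<le> B * (1 + 2 * s) ^ n" if "norm (0 - z) = s" for z
      using p_le [of z] that by simp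
  qed fact
  ultimately have "fact r * \<bar>c r\<bar> \<le> fact r * (B * (1 + 2 * s) ^ n / s ^ r)"
    by (simp add: norm_mult)
  then show ?thesis
    by (simp only: mult_le_cancel_left_pos fact_gt_zero)
qed

lemma power_le_fact_exp:
  fixes x :: real
  assumes "0 \<le> x"
  shows "x ^ n \<le> fact n * exp x"
proof -
  have "x ^ n / fact n \<le> exp x"
    using sum_le_suminf [OF summable_exp [of x], of "{n}"] assms
    by (simp add: exp_def scaleR_conv_of_real field_simps)
  then show ?thesis
    by (simp add: field_simps)
qed

text \<open>A local Kolmogorov inequality, whose constant \<open>exp 3 ^ r\<close> does not involve the top order \<open>L\<close>.
  On an interval of half-length \<open>L / (exp 1 * R)\<close> the remainder term of order \<open>L\<close> is at most
  \<open>\<epsilon> * L ^ L / (exp L * fact L) \<le> \<epsilon>\<close>, so the Taylor polynomial at \<open>0\<close> is bounded by \<open>2 * \<epsilon>\<close>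
  there, and \<open>polynomial_coefficient_bound\<close> controls its coefficients. Composing instead Landau's
  inequality between three consecutive derivatives would give constants like \<open>2 ^ (r * (L - r) / 2)\<close>.\<close>

lemma derivative_bound_at_centre:
  fixes diff :: "nat \<Rightarrow> real \<Rightarrow> real"
  assumes deriv: "\<And>m t. (diff m has_real_derivative diff (Suc m) t) (at t)"
    and zero: "\<And>t. \<bar>t\<bar> \<le> h \<Longrightarrow> \<bar>diff 0 t\<bar> \<le> \<epsilon>"
    and top: "\<And>t. \<bar>t\<bar> \<le> h \<Longrightarrow> \<bar>diff L t\<bar> \<le> \<epsilon> * R ^ L"
    and "0 < R" and "real L / R \<le> h" and "r \<le> L"
  shows "\<bar>diff r 0\<bar> \<le> 2 * \<epsilon> * (exp 3 * R) ^ r"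
proof -
  have h: "0 \<le> h"
    using \<open>0 < R\<close> \<open>real L / R \<le> h\<close> by (meson divide_nonneg_pos of_nat_0_le_iff order_trans)
  have eps: "0 \<le> \<epsilon>"
    using zero [of 0] h by simp
  consider "r = 0" | "r = L" | "0 < r" "r < L"
    using \<open>r \<le> L\<close> by linarith
  then show ?thesis
  proof cases
    case 1
    then show ?thesis
      using zero [of 0] h eps by simp
  next
    case 2
    have "\<bar>diff r 0\<bar> \<le> \<epsilon> * R ^ r"
      using top [of 0] h 2 by simp
    also have "\<dots> \<le> 2 * \<epsilon> * (exp 3 * R) ^ r"
      using eps \<open>0 < R\<close> by (intro mult_mono power_mono) (auto simp: mult_le_cancel_right1)
    finally show ?thesis .
  next
    case 3
    define \<eta> where "\<eta> = real L / (exp 1 * R)"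
    have eta: "0 < \<eta>"
      using 3 \<open>0 < R\<close> by (simp add: \<eta>_def)
    have "\<eta> \<le> real L / R"
      using \<open>0 < R\<close> 3 by (simp add: \<eta>_def frac_le mult_le_cancel_right1)
    then have eta_h: "\<eta> \<le> h"
      using \<open>real L / R \<le> h\<close> by simp
    define c where "c m = (if m < L then diff m 0 / fact m * \<eta> ^ m else 0)" for m
    have "\<bar>\<Sum>m\<le>L. c m * t ^ m\<bar> \<le> 2 * \<epsilon>" if t: "\<bar>t\<bar> \<le> 1" for t
    proof -
      have le: "\<bar>t * \<eta>\<bar> \<le> \<eta>"
        using t eta by (simp add: abs_mult mult_le_cancel_right1)
      obtain u where u: "\<bar>u\<bar> \<le> \<bar>t * \<eta>\<bar>"
        "diff 0 (t * \<eta>) = (\<Sum>m<L. diff m 0 / fact m * (t * \<eta>) ^ m)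
            + diff L u / fact L * (t * \<eta>) ^ L"
        using Maclaurin_bi_le [of diff "diff 0" L "t * \<eta>"] deriv by blast
      have "(\<Sum>m\<le>L. c m * t ^ m) = (\<Sum>m<L. diff m 0 / fact m * (t * \<eta>) ^ m)"
        unfolding lessThan_Suc_atMost [symmetric]
        by (simp add: c_def power_mult_distrib mult_ac)
      also have "\<dots> = diff 0 (t * \<eta>) - diff L u / fact L * (t * \<eta>) ^ L"
        using u(2) by simp
      finally have "\<bar>\<Sum>m\<le>L. c m * t ^ m\<bar> \<le> \<bar>diff 0 (t * \<eta>)\<bar> + \<bar>diff L u\<bar> / fact L * \<bar>t * \<eta>\<bar> ^ L"
        using abs_triangle_ineq4 [of "diff 0 (t * \<eta>)" "diff L u / fact L * (t * \<eta>) ^ L"]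
        by (simp add: abs_mult power_abs)
      also have "\<dots> \<le> \<epsilon> + \<epsilon> * R ^ L / fact L * \<eta> ^ L"
        using zero [of "t * \<eta>"] top [of u] u(1) le eta_h eps \<open>0 < R\<close>
        by (intro add_mono mult_mono divide_right_mono power_mono) auto
      also have "\<dots> = \<epsilon> + \<epsilon> * (real L ^ L / (fact L * exp (real L)))"
        using \<open>0 < R\<close> by (simp add: \<eta>_def power_divide power_mult_distrib exp_of_nat_mult [symmetric])
      also have "\<dots> \<le> \<epsilon> + \<epsilon> * 1"
        using eps power_le_fact_exp [of "real L" L] by (intro add_left_mono mult_left_mono) auto
      finally show ?thesis
        by simp
    qed
    \<comment> \<open>With \<open>s = r / L\<close> the growth factor \<open>(1 + 2 * s) ^ L\<close> is at most \<open>exp 2 ^ r\<close>.\<close>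
    from polynomial_coefficient_bound [OF this, of r "real r / real L"]
    have *: "\<bar>c r\<bar> \<le> 2 * \<epsilon> * (1 + 2 * (real r / real L)) ^ L / (real r / real L) ^ r"
      using 3 by simp
    have "(1 + 2 * (real r / real L)) ^ L \<le> exp (2 * (real r / real L)) ^ L"
      by (intro power_mono) (auto simp: exp_ge_add_one_self)
    also have "\<dots> = exp 2 ^ r"
      using 3 by (simp add: exp_of_nat_mult [symmetric] mult.commute)
    finally have "\<bar>c r\<bar> \<le> 2 * \<epsilon> * exp 2 ^ r / (real r / real L) ^ r"
      using eps by (intro order_trans [OF *] divide_right_mono mult_left_mono) auto
    moreover have "\<bar>c r\<bar> = \<bar>diff r 0\<bar> / fact r * \<eta> ^ r"
      using 3 eta by (simp add: c_def abs_mult)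
    ultimately have "\<bar>diff r 0\<bar> / fact r * \<eta> ^ r \<le> 2 * \<epsilon> * exp 2 ^ r / (real r / real L) ^ r"
      by simp
    then have "\<bar>diff r 0\<bar> / fact r \<le> 2 * \<epsilon> * exp 2 ^ r / (real r / real L) ^ r / \<eta> ^ r"
      using eta by (subst pos_le_divide_eq) auto
    then have "\<bar>diff r 0\<bar> \<le> 2 * \<epsilon> * exp 2 ^ r / (real r / real L) ^ r / \<eta> ^ r * fact r"
      by (subst (asm) pos_divide_le_eq) auto
    also have "\<dots> = (fact r / real r ^ r) * (2 * \<epsilon> * (exp 2 * (exp 1 * R)) ^ r)"
      using 3 \<open>0 < R\<close> by (simp add: \<eta>_def power_divide power_mult_distrib field_simps)
    also have "\<dots> \<le> 1 * (2 * \<epsilon> * (exp 2 * (exp 1 * R)) ^ r)"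
      using eps \<open>0 < R\<close> 3 fact_le_power [of r, where ?'a = real] by (intro mult_right_mono) auto
    also have "\<dots> = 2 * \<epsilon> * (exp 3 * R) ^ r"
      by (simp add: mult.assoc [symmetric] exp_add [symmetric])
    finally show ?thesis .
  qed
qed

section \<open>Interpolation of partial derivatives\<close>

lemma smooth_partial: "smooth f \<Longrightarrow> smooth (partial i f)"
  unfolding smooth_def by (metis C_k.simps(2))

lemma smooth_funpow_partial: "smooth f \<Longrightarrow> smooth ((partial i ^^ m) f)"
  by (induction m) (auto intro: smooth_partial)

lemma smooth_foldr_partial: "smooth f \<Longrightarrow> smooth (foldr (\<lambda>i. partial i ^^ \<beta> i) is f)"
  by (induction "is") (auto intro: smooth_funpow_partial)

lemma has_vector_derivative_partial:
  assumes "smooth f"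
  shows "((\<lambda>t. f (x + t *\<^sub>R axis i 1)) has_vector_derivative partial i f (x + t *\<^sub>R axis i 1)) (at t)"
proof -
  have "C_k (Suc 0) f"
    using assms by (simp only: smooth_def)
  then have "f differentiable at (x + t *\<^sub>R axis i 1)"
    by (simp add: differentiable_on_def)
  then obtain f' where f': "(f has_derivative f') (at (x + t *\<^sub>R axis i 1))"
    by (auto simp: differentiable_def)
  have along: "((\<lambda>s. f (y + s *\<^sub>R axis i 1)) has_vector_derivative f' (axis i 1)) (at u)"
    if "y + u *\<^sub>R axis i 1 = x + t *\<^sub>R axis i 1" for y u
  proof -
    have "((\<lambda>s. y + s *\<^sub>R axis i 1) has_derivative (\<lambda>s. s *\<^sub>R axis i 1)) (at u)"
      by (auto intro!: derivative_eq_intros)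
    from has_derivative_compose [OF this, of f f'] f' that
    have "((\<lambda>s. f (y + s *\<^sub>R axis i 1)) has_derivative (\<lambda>s. f' (s *\<^sub>R axis i 1))) (at u)"
      by simp
    then show ?thesis
      by (simp add: has_vector_derivative_def linear_simps(5) [OF has_derivative_bounded_linear [OF f']])
  qed
  have "partial i f (x + t *\<^sub>R axis i 1) = f' (axis i 1)"
    unfolding partial_def by (intro vector_derivative_at along) simp
  with along [of x t] show ?thesis
    by simp
qed

text \<open>To apply the real inequality to a complex-valued function, rotate it by a unimodular factor \<open>w\<close>
  that makes the derivative to be estimated real and nonnegative, and pass to real parts.\<close>

lemma funpow_partial_bound_at_centre:
  assumes "smooth F"
    and zero: "\<And>t. \<bar>t\<bar> \<le> h \<Longrightarrow> norm (F (x + t *\<^sub>R axis i 1)) \<le> \<epsilon>"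
    and top: "\<And>t. \<bar>t\<bar> \<le> h \<Longrightarrow> norm ((partial i ^^ L) F (x + t *\<^sub>R axis i 1)) \<le> \<epsilon> * R ^ L"
    and "0 < R" and "real L / R \<le> h" and "r \<le> L"
  shows "norm ((partial i ^^ r) F x) \<le> 2 * \<epsilon> * (exp 3 * R) ^ r"
proof -
  define w where "w = cnj (sgn ((partial i ^^ r) F x))"
  have w: "norm w \<le> 1"
    by (simp add: w_def norm_sgn)
  define diff where "diff m t = Re (w * (partial i ^^ m) F (x + t *\<^sub>R axis i 1))" for m t
  have diff_le: "\<bar>diff m t\<bar> \<le> norm ((partial i ^^ m) F (x + t *\<^sub>R axis i 1))" for m t
  proof -
    have "\<bar>diff m t\<bar> \<le> norm (w * (partial i ^^ m) F (x + t *\<^sub>R axis i 1))"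
      unfolding diff_def by (rule abs_Re_le_cmod)
    also have "\<dots> \<le> 1 * norm ((partial i ^^ m) F (x + t *\<^sub>R axis i 1))"
      unfolding norm_mult using w by (intro mult_right_mono) auto
    finally show ?thesis
      by simp
  qed
  have "\<bar>diff r 0\<bar> \<le> 2 * \<epsilon> * (exp 3 * R) ^ r"
  proof (rule derivative_bound_at_centre)
    fix m t
    have "((\<lambda>t. (partial i ^^ m) F (x + t *\<^sub>R axis i 1)) has_vector_derivative
        (partial i ^^ Suc m) F (x + t *\<^sub>R axis i 1)) (at t)"
      using has_vector_derivative_partial [OF smooth_funpow_partial [OF \<open>smooth F\<close>]] by simp
    then have "((\<lambda>t. Re (w * (partial i ^^ m) F (x + t *\<^sub>R axis i 1))) has_vector_derivative
        Re (w * (partial i ^^ Suc m) F (x + t *\<^sub>R axis i 1))) (at t)"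
      by (intro bounded_linear.has_vector_derivative [OF bounded_linear_Re]
          bounded_linear.has_vector_derivative [OF bounded_linear_mult_right])
    then show "(diff m has_real_derivative diff (Suc m) t) (at t)"
      unfolding diff_def has_real_derivative_iff_has_vector_derivative .
  next
    show "\<bar>diff 0 t\<bar> \<le> \<epsilon>" if "\<bar>t\<bar> \<le> h" for t
      using diff_le [of 0 t] zero [OF that] by simp
    show "\<bar>diff L t\<bar> \<le> \<epsilon> * R ^ L" if "\<bar>t\<bar> \<le> h" for t
      using diff_le [of L t] top [OF that] by simp
  qed fact+
  moreover have "diff r 0 = norm ((partial i ^^ r) F x)"
  proof -
    have "cnj (sgn z) * z = of_real (norm z)" for z :: complex
    proof (cases "z = 0")
      case False
      have "cnj (sgn z) * z = of_real ((norm z)\<^sup>2 / norm z)"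
        by (simp add: sgn_eq mult.commute complex_norm_square [symmetric] del: of_real_power)
      then show ?thesis
        using False by (simp add: power2_eq_square)
    qed simp
    then show ?thesis
      by (simp add: diff_def w_def)
  qed
  ultimately show ?thesis
    by simp
qed

lemma mi_size_sum_list: "mi_size \<beta> = sum_list (map \<beta> coords)"
  by (simp add: mi_size_def sum_list_distinct_conv_sum_set [OF coords(1)] coords(2))

lemma foldr_funpow_partial_zero:
  "(\<And>i. i \<in> set is \<Longrightarrow> \<beta> i = 0) \<Longrightarrow> foldr (\<lambda>i. partial i ^^ \<beta> i) is f = f"
  by (induction "is") auto

text \<open>The variables are treated one at a time, in the order in which \<^const>\<open>mi_deriv\<close> applies them.
  If the derivatives in the directions \<open>is\<close>, of total order \<open>s\<close>, are bounded, then the bound on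
  the derivatives of order \<open>N\<close> serves as the top bound of order \<open>N - s\<close> in the next
  direction \<open>i\<close>: the multiindex \<open>\<gamma>\<close> below agrees with \<open>\<beta>\<close> on \<open>is\<close>, gives all the remaining order to
  \<open>i\<close>, and is zero on the directions that come later, so that \<open>mi_deriv \<gamma> f\<close> is literally the
  iterated derivative in direction \<open>i\<close> of the function reached so far. Each direction uses up a
  distance \<open>h\<close>, whence the cubes of shrinking size.\<close>

lemma foldr_partial_bound_at_centre:
  fixes f :: "real ^ 'n::finite \<Rightarrow> complex"
  assumes "smooth f" and "0 < R" and "real N / R \<le> h"
    and zero: "\<And>y. (\<And>i. \<bar>y $ i - x $ i\<bar> \<le> real CARD('n) * h) \<Longrightarrow> norm (f y) \<le> \<epsilon>"
    and top: "\<And>\<gamma> y. mi_size \<gamma> = N \<Longrightarrow> norm (mi_deriv \<gamma> f y) \<le> \<epsilon> * R ^ N"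
    and "mi_size \<beta> \<le> N"
    and "coords = pre @ is"
    and "\<And>i. \<bar>y $ i - x $ i\<bar> \<le> real (length pre) * h"
  shows "norm (foldr (\<lambda>i. partial i ^^ \<beta> i) is f y)
    \<le> 2 ^ length is * \<epsilon> * (exp 3 * R) ^ sum_list (map \<beta> is)"
  using assms(7,8)
proof (induction "is" arbitrary: pre y)
  case Nil
  have "length (coords :: 'n list) = CARD('n)"
    using coords distinct_card by metis
  then show ?case
    using Nil by (auto intro!: zero)
next
  case (Cons i "is")
  have h: "0 \<le> h"
    using \<open>0 < R\<close> \<open>real N / R \<le> h\<close> by (meson divide_nonneg_pos of_nat_0_le_iff order_trans)
  have "norm (f x) \<le> \<epsilon>"
    using h by (intro zero) simp
  then have eps: "0 \<le> \<epsilon>"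
    using norm_ge_zero order_trans by blast
  define F where "F = foldr (\<lambda>i. partial i ^^ \<beta> i) is f"
  define s where "s = sum_list (map \<beta> is)"
  define \<epsilon>' where "\<epsilon>' = 2 ^ length is * \<epsilon> * (exp 3 * R) ^ s"
  have size: "s + \<beta> i \<le> N"
    using \<open>mi_size \<beta> \<le> N\<close> by (simp add: mi_size_sum_list Cons.prems(1) s_def)
  have dist: "distinct (pre @ i # is)"
    using coords(1) Cons.prems(1) by metis
  have near: "\<bar>(y + t *\<^sub>R axis i 1) $ j - x $ j\<bar> \<le> real (length (pre @ [i])) * h" if "\<bar>t\<bar> \<le> h" for t j
  proof -
    have "\<bar>(y + t *\<^sub>R axis i 1) $ j - x $ j\<bar> \<le> \<bar>y $ j - x $ j\<bar> + \<bar>t\<bar>"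
      by (auto simp: axis_def)
    also have "\<dots> \<le> real (length pre) * h + h"
      using Cons.prems(2) that by (intro add_mono) auto
    finally show ?thesis
      by (simp add: algebra_simps)
  qed
  have "norm ((partial i ^^ \<beta> i) F y) \<le> 2 * \<epsilon>' * (exp 3 * R) ^ \<beta> i"
  proof (rule funpow_partial_bound_at_centre [where L = "N - s" and h = h])
    show "smooth F"
      unfolding F_def using \<open>smooth f\<close> by (rule smooth_foldr_partial)
    show "norm (F (y + t *\<^sub>R axis i 1)) \<le> \<epsilon>'" if "\<bar>t\<bar> \<le> h" for t
      unfolding F_def \<epsilon>'_def s_def using Cons.prems(1) near [OF that]
      by (intro Cons.IH [of "pre @ [i]"]) auto
    show "norm ((partial i ^^ (N - s)) F (y + t *\<^sub>R axis i 1)) \<le> \<epsilon>' * R ^ (N - s)" for t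
    proof -
      define \<gamma> where "\<gamma> j = (if j = i then N - s else if j \<in> set is then \<beta> j else 0)" for j
      have gamma_is: "map \<gamma> is = map \<beta> is" "sum_list (map \<gamma> pre) = 0"
        using dist by (auto simp: \<gamma>_def sum_list_eq_0_iff)
      have "\<gamma> i = N - s"
        by (simp add: \<gamma>_def)
      then have "mi_size \<gamma> = N"
        using size unfolding mi_size_sum_list Cons.prems(1)
        by (simp add: gamma_is s_def [symmetric] \<open>\<gamma> i = N - s\<close>)
      moreover have "foldr (\<lambda>i. partial i ^^ \<gamma> i) is f = F"
        unfolding F_def using dist by (intro foldr_cong) (auto simp: \<gamma>_def)
      then have "mi_deriv \<gamma> f = (partial i ^^ (N - s)) F"
        using dist unfolding mi_deriv_def Cons.prems(1)
        by (simp, subst foldr_funpow_partial_zero) (auto simp: \<gamma>_def)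
      ultimately have "norm ((partial i ^^ (N - s)) F (y + t *\<^sub>R axis i 1)) \<le> \<epsilon> * R ^ N"
        using top [of \<gamma>] by simp
      also have "\<dots> = 1 * \<epsilon> * (1 * R) ^ s * R ^ (N - s)"
        using size by (simp add: mult.assoc power_add [symmetric])
      also have "\<dots> \<le> 2 ^ length is * \<epsilon> * (exp 3 * R) ^ s * R ^ (N - s)"
        using eps \<open>0 < R\<close> by (intro mult_mono power_mono) auto
      finally show ?thesis
        by (simp add: \<epsilon>'_def)
    qed
    have "real (N - s) / R \<le> real N / R"
      using \<open>0 < R\<close> by (intro divide_right_mono) auto
    then show "real (N - s) / R \<le> h"
      using \<open>real N / R \<le> h\<close> by simp
    show "\<beta> i \<le> N - s"
      using size by simp
  qed fact
  then show ?case
    by (simp add: F_def \<epsilon>'_def s_def power_add mult_ac)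
qed

text \<open>Here \<open>\<epsilon>\<close>, the local bound on \<open>f\<close>, may be far smaller than the constant \<open>C\<close> in the bound on its
  derivatives of order \<open>N\<close>. Replacing \<open>R\<close> by \<open>R * root N (C / \<epsilon>)\<close> balances the two; for orders up to
  \<open>N / 2\<close> at most the factor \<open>sqrt (C / \<epsilon>)\<close> is lost, which leaves the geometric mean of \<open>\<epsilon>\<close> and
  \<open>C\<close>. Increasing \<open>R\<close> only shrinks the cube that is needed.\<close>

lemma mi_deriv_interpolation:
  fixes f :: "real ^ 'n::finite \<Rightarrow> complex"
  assumes "smooth f" and "0 < R" and "real N / R \<le> h"
    and "0 < \<epsilon>" and "\<epsilon> \<le> C"
    and zero: "\<And>y. (\<And>i. \<bar>y $ i - x $ i\<bar> \<le> real CARD('n) * h) \<Longrightarrow> norm (f y) \<le> \<epsilon>"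
    and top: "\<And>\<gamma> y. mi_size \<gamma> = N \<Longrightarrow> norm (mi_deriv \<gamma> f y) \<le> C * R ^ N"
    and "2 * mi_size \<beta> \<le> N" and "0 < N"
  shows "norm (mi_deriv \<beta> f x) \<le> 2 ^ CARD('n) * sqrt (\<epsilon> * C) * (exp 3 * R) ^ mi_size \<beta>"
proof -
  define q where "q = root N (C / \<epsilon>)"
  have q1: "1 \<le> q"
    using assms by (simp add: q_def real_root_ge_1_iff)
  have qN: "q ^ N = C / \<epsilon>"
    using assms by (simp add: q_def)
  have len: "length (coords :: 'n list) = CARD('n)"
    using coords distinct_card by metis
  have "norm (foldr (\<lambda>i. partial i ^^ \<beta> i) coords f x)
    \<le> 2 ^ length (coords :: 'n list) * \<epsilon> * (exp 3 * (R * q)) ^ sum_list (map \<beta> coords)"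
  proof (rule foldr_partial_bound_at_centre [where h = h and pre = "[]"])
    have "real N / (R * q) \<le> real N / R"
      using q1 \<open>0 < R\<close> by (intro divide_left_mono) (auto simp: mult_le_cancel_left1)
    then show "real N / (R * q) \<le> h"
      using \<open>real N / R \<le> h\<close> by simp
    show "norm (mi_deriv \<gamma> f y) \<le> \<epsilon> * (R * q) ^ N" if "mi_size \<gamma> = N" for \<gamma> y
      using top [OF that, of y] \<open>0 < \<epsilon>\<close> by (simp add: power_mult_distrib qN mult.commute)
  qed (use assms q1 in auto)
  then have le: "norm (mi_deriv \<beta> f x)
      \<le> 2 ^ CARD('n) * (\<epsilon> * q ^ mi_size \<beta>) * (exp 3 * R) ^ mi_size \<beta>"
    by (simp add: mi_deriv_def len mi_size_sum_list power_mult_distrib mult_ac)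
  have "(q ^ mi_size \<beta>)\<^sup>2 \<le> C / \<epsilon>"
    unfolding power_mult [symmetric] qN [symmetric] using q1 assms
    by (intro power_increasing) auto
  then have "(\<epsilon> * q ^ mi_size \<beta>)\<^sup>2 \<le> \<epsilon> * C"
    using \<open>0 < \<epsilon>\<close> by (simp add: power_mult_distrib power2_eq_square field_simps)
  then have "\<epsilon> * q ^ mi_size \<beta> \<le> sqrt (\<epsilon> * C)"
    by (rule real_le_rsqrt)
  with le show ?thesis
    by (elim order_trans, intro mult_right_mono mult_left_mono) (use \<open>0 < R\<close> in auto)
qed

section \<open>Weight sequences\<close>

lemma root_seq_power: "weight_sequence M \<Longrightarrow> root_seq M n ^ n = M n"
  by (auto simp: root_seq_def weight_sequence_def less_imp_le)

lemma root_seq_pos: "weight_sequence M \<Longrightarrow> 0 < root_seq M n"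
  by (auto simp: root_seq_def weight_sequence_def)

lemma weight_le_quot_seq_power:
  assumes "weight_sequence M"
  shows "M n \<le> quot_seq M (Suc n) ^ n"
proof (induction n)
  case 0
  then show ?case
    using assms by (simp add: weight_sequence_def)
next
  case (Suc n)
  have pos: "0 < M i" for i
    using assms by (simp add: weight_sequence_def)
  have "M (Suc n) = M n * quot_seq M (Suc n)"
    using pos [of n] by (simp add: quot_seq_def)
  also have "\<dots> \<le> quot_seq M (Suc n) ^ n * quot_seq M (Suc n)"
    using pos by (intro mult_right_mono Suc.IH) (simp add: quot_seq_def less_imp_le)
  also have "\<dots> = quot_seq M (Suc n) ^ Suc n"
    by simp
  also have "\<dots> \<le> quot_seq M (Suc (Suc n)) ^ Suc n"
    using assms pos by (intro power_mono) (auto simp: weight_sequence_def quot_seq_def less_imp_le)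
  finally show ?case .
qed

text \<open>By the preceding lemma \<open>root_seq M n\<close>, the geometric mean of the first \<open>n\<close> quotients, does not
  exceed the next quotient.\<close>

lemma incseq_root_seq:
  assumes "weight_sequence M"
  shows "incseq (root_seq M)"
proof (rule incseq_SucI)
  fix n
  have pos: "0 < M i" for i
    using assms by (simp add: weight_sequence_def)
  show "root_seq M n \<le> root_seq M (Suc n)"
  proof (cases "n = 0")
    case True
    then show ?thesis
      using assms by (simp add: root_seq_def weight_sequence_def)
  next
    case False
    have "M n ^ Suc n = M n ^ n * M n"
      by simp
    also have "\<dots> \<le> M n ^ n * quot_seq M (Suc n) ^ n"
      using pos by (intro mult_left_mono weight_le_quot_seq_power assms) (simp add: less_imp_le)
    also have "\<dots> = M (Suc n) ^ n"
      using pos [of n] by (simp add: quot_seq_def power_mult_distrib [symmetric])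
    finally have "(root_seq M n ^ n) ^ Suc n \<le> (root_seq M (Suc n) ^ Suc n) ^ n"
      by (simp only: root_seq_power [OF assms])
    then have "root_seq M n ^ (n * Suc n) \<le> root_seq M (Suc n) ^ (n * Suc n)"
      by (simp only: power_mult [symmetric] mult.commute)
    then show ?thesis
      using False root_seq_pos [OF assms] by (subst (asm) power_mono_iff) (auto simp: less_imp_le)
  qed
qed

lemma root_seq_double_le:
  assumes "weight_sequence M" and "moderate_growth M"
  obtains K where "1 \<le> K" and "\<And>n. root_seq M (2 * n) \<le> K * root_seq M n"
proof -
  have pos: "0 < M i" for i
    using assms by (simp add: weight_sequence_def)
  obtain B where B: "\<And>j k. j \<ge> 1 \<Longrightarrow> k \<ge> 1 \<Longrightarrow> root (j + k) (M (j + k) / (M j * M k)) \<le> B"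
    using assms(2) unfolding moderate_growth_def bdd_above_def by blast
  have "root_seq M (2 * n) \<le> max 1 B * root_seq M n" for n
  proof (cases "n = 0")
    case True
    then show ?thesis
      by (simp add: root_seq_def)
  next
    case False
    define q where "q = root (n + n) (M (n + n) / (M n * M n))"
    have q0: "0 \<le> q"
      unfolding q_def using pos
      by (intro real_root_ge_zero divide_nonneg_nonneg mult_nonneg_nonneg less_imp_le)
    have q_power: "q ^ (n + n) = M (n + n) / (M n * M n)"
      unfolding q_def using False pos
      by (intro real_root_pow_pos2 divide_nonneg_nonneg mult_nonneg_nonneg less_imp_le) auto
    have "root_seq M (n + n) ^ (n + n) = q ^ (n + n) * (M n * M n)"
      unfolding q_power root_seq_power [OF assms(1)] using pos [of n] by simp
    also have "\<dots> = (q * root_seq M n) ^ (n + n)"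
      by (simp only: power_mult_distrib) (simp add: power_add root_seq_power [OF assms(1)])
    finally have "root_seq M (n + n) = q * root_seq M n"
      using False q0 root_seq_pos [OF assms(1)]
      by (subst (asm) power_eq_iff_eq_base) (auto simp: less_imp_le)
    moreover have "q \<le> max 1 B"
      using B [of n n] False by (simp add: q_def)
    ultimately show ?thesis
      using root_seq_pos [OF assms(1), of n] by (simp add: mult_2 mult_right_mono)
  qed
  then show thesis
    by (intro that [of "max 1 B"]) auto
qed

text \<open>The first base index beyond \<open>2 * n\<close>: its predecessor is at most \<open>2 * n\<close>, so the bounded ratios
  compare the root at this index with the one at \<open>2 * n\<close>, and moderate growth compares that one
  with the root at \<open>n\<close>. The gaps of the base sequence may be arbitrarily large.\<close>

lemma base_index_beyond_double:
  assumes "weight_sequence M" and "moderate_growth M" and "base_sequence k"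
    and "bdd_above (range (\<lambda>j. root_seq M (k (j + 1)) / root_seq M (k j)))"
  obtains K where "1 \<le> K"
    and "\<And>n. \<exists>j. 2 * n < k j \<and> root_seq M (k j) \<le> K * root_seq M n"
proof -
  obtain D where D: "1 \<le> D" "\<And>n. root_seq M (2 * n) \<le> D * root_seq M n"
    using root_seq_double_le [OF assms(1,2)] by blast
  obtain B where B: "\<And>j. root_seq M (k (j + 1)) / root_seq M (k j) \<le> B"
    using assms(4) unfolding bdd_above_def by blast
  have "\<exists>j. 2 * n < k j \<and> root_seq M (k j) \<le> max 1 B * D * root_seq M n" for n
  proof -
    define j where "j = (LEAST j. 2 * n < k j)"
    have "Suc (2 * n) \<le> k (Suc (2 * n))"
      using assms(3) by (intro strict_mono_imp_increasing) (simp add: base_sequence_def)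
    then have "2 * n < k (Suc (2 * n))"
      by simp
    then have j: "2 * n < k j"
      unfolding j_def by (rule LeastI)
    then obtain i where i: "j = Suc i"
      using assms(3) by (cases j) (auto simp: base_sequence_def)
    then have "\<not> 2 * n < k i"
      using not_less_Least [of i "\<lambda>j. 2 * n < k j"] by (simp add: j_def)
    then have "root_seq M (k i) \<le> root_seq M (2 * n)"
      by (intro incseqD [OF incseq_root_seq [OF assms(1)]]) simp
    then have le: "root_seq M (k i) \<le> D * root_seq M n"
      using D(2) [of n] by simp
    have "root_seq M (k j) = root_seq M (k (i + 1)) / root_seq M (k i) * root_seq M (k i)"
      using root_seq_pos [OF assms(1), of "k i"] by (simp add: i)
    also have "\<dots> \<le> max 1 B * (D * root_seq M n)"
      using B [of i] le root_seq_pos [OF assms(1)]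
      by (intro mult_mono) (auto simp: less_imp_le le_max_iff_disj)
    finally show ?thesis
      using j by (auto simp: mult.assoc)
  qed
  moreover have "1 \<le> max 1 B * D"
    using mult_mono [of 1 "max 1 B" 1 D] D(1) by simp
  ultimately show thesis
    using that by blast
qed

section \<open>From lacunary to mixed bounds\<close>

lemma abs_mi_power_le:
  assumes "\<And>i. \<bar>x $ i\<bar> \<le> r"
  shows "\<bar>mi_power x \<alpha>\<bar> \<le> r ^ mi_size \<alpha>"
proof -
  have "\<bar>mi_power x \<alpha>\<bar> \<le> (\<Prod>i\<in>UNIV. r ^ \<alpha> i)"
    unfolding mi_power_def abs_prod using assms by (intro prod_mono) (auto simp: power_abs power_mono)
  then show ?thesis
    by (simp add: mi_size_def power_sum)
qed

lemma mi_size_single: "mi_size (\<lambda>j. if j = i then p else 0) = p"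
  by (simp add: mi_size_def)

lemma mi_power_single: "mi_power x (\<lambda>j. if j = i then p else 0) = (x $ i) ^ p"
  unfolding mi_power_def by (simp add: if_distrib [of "\<lambda>p. _ ^ p"] prod.delta cong: if_cong)

lemma mi_size_zero: "mi_size (\<lambda>_. 0) = 0"
  by (simp add: mi_size_def)

lemma mi_power_zero: "mi_power x (\<lambda>_. 0) = 1"
  by (simp add: mi_power_def)

lemma mi_deriv_zero: "mi_deriv (\<lambda>_. 0) f = f"
  unfolding mi_deriv_def by (rule foldr_funpow_partial_zero) simp

lemma lacunary_bound_imp_bounded:
  assumes "lacunary_bound M k l C \<rho> \<sigma> f" and "base_sequence k"
  shows "norm (f x) \<le> C"
proof -
  have "norm (mi_power x (\<lambda>_. 0) *\<^sub>R f x) \<le> C * (\<rho> * root_seq M (k 0)) ^ k 0"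
    using assms unfolding lacunary_bound_def by (metis base_sequence_def mi_size_zero)
  then show ?thesis
    using assms(2) by (simp add: mi_power_zero base_sequence_def)
qed

text \<open>Bounds for \<open>f\<close> with the powers \<open>0\<close> and \<open>k j\<close> give all powers in between. Below the
  threshold \<open>\<rho> * root_seq M (k j)\<close> the estimate of \<open>f\<close> itself suffices; above it, dividing
  the estimate of order \<open>k j\<close> by surplus powers of the coordinate costs nothing.\<close>

lemma lacunary_bound_decay:
  assumes "lacunary_bound M k l C \<rho> \<sigma> f" and "base_sequence k"
    and "0 \<le> \<rho>" and "0 \<le> root_seq M (k j)" and "p \<le> k j"
  shows "norm (f y) * \<bar>y $ i\<bar> ^ p \<le> C * (\<rho> * root_seq M (k j)) ^ p"
proof -
  define A where "A = \<rho> * root_seq M (k j)"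
  have A: "0 \<le> A"
    using assms by (simp add: A_def)
  have f_le: "norm (f y) \<le> C"
    using assms(1,2) by (rule lacunary_bound_imp_bounded)
  have C: "0 \<le> C"
    using norm_ge_zero f_le by (rule order_trans)
  show ?thesis
  proof (cases "\<bar>y $ i\<bar> \<le> A")
    case True
    then show ?thesis
      unfolding A_def [symmetric] using f_le C by (intro mult_mono power_mono) auto
  next
    case False
    have "norm (mi_power y (\<lambda>j'. if j' = i then k j else 0) *\<^sub>R f y) \<le> C * A ^ k j"
      unfolding A_def using assms(1) mi_size_single unfolding lacunary_bound_def by blast
    then have "norm (f y) * \<bar>y $ i\<bar> ^ k j \<le> C * A ^ k j"
      by (simp add: mi_power_single power_abs mult.commute)
    also have "\<dots> = C * A ^ p * A ^ (k j - p)"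
      using \<open>p \<le> k j\<close> by (simp add: power_add [symmetric])
    also have "\<dots> \<le> C * A ^ p * \<bar>y $ i\<bar> ^ (k j - p)"
      using False A C by (intro mult_left_mono power_mono) auto
    finally have "(norm (f y) * \<bar>y $ i\<bar> ^ p) * \<bar>y $ i\<bar> ^ (k j - p) \<le> C * A ^ p * \<bar>y $ i\<bar> ^ (k j - p)"
      using \<open>p \<le> k j\<close> by (simp add: mult.assoc power_add [symmetric])
    then show ?thesis
      unfolding A_def [symmetric] by (rule mult_right_le_imp_le) (use False A in auto)
  qed
qed

text \<open>The quantitative core: the new parameters are fixed multiples of the old ones, so that the same
  statement serves both classes. For a given pair of orders \<open>a\<close> and \<open>b\<close>, take base indices beyond
  \<open>2 * a\<close> and \<open>2 * b\<close>. Far from the origin the decay of \<open>f\<close> of order \<open>2 * a\<close> holds, with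
  \<open>\<rho>\<close> doubled, on a whole cube around \<open>x\<close>, and the geometric mean in the interpolation lemma
  halves the exponent to \<open>a\<close>. Near the origin the power of \<open>x\<close> is bounded by \<open>(2 * H) ^ a\<close>. The bound on
  \<open>j / root_seq M j\<close> enters twice: it makes the size \<open>H\<close> of the cubes independent of \<open>b\<close>, and it lets
  \<open>\<rho> ^ a * M a\<close> dominate \<open>(2 * H) ^ a\<close> up to a constant.\<close>

proposition lacunary_bound_imp_GS_bound:
  fixes M :: "nat \<Rightarrow> real"
  assumes base: "base_sequence k" "base_sequence l"
    and weight: "weight_sequence M" and "moderate_growth M"
    and "bdd_above (range (\<lambda>j. root_seq M (k (j + 1)) / root_seq M (k j)))"
    and "bdd_above (range (\<lambda>j. root_seq M (l (j + 1)) / root_seq M (l j)))"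
    and "bdd_above (range (\<lambda>j. real j / root_seq M j))"
  shows "\<exists>A>0. \<exists>B>0. \<forall>C>0. \<forall>\<rho>>0. \<forall>\<sigma>>0. \<forall>f :: real ^ 'n::finite \<Rightarrow> complex.
    smooth f \<longrightarrow> lacunary_bound M k l C \<rho> \<sigma> f \<longrightarrow> GS_bound M (A * \<rho>) (B * \<sigma>) f"
proof -
  obtain K where K: "1 \<le> K"
    "\<And>n. \<exists>j. 2 * n < k j \<and> root_seq M (k j) \<le> K * root_seq M n"
    using base_index_beyond_double [OF weight assms(4) base(1) assms(5)] by blast
  obtain L where L: "1 \<le> L"
    "\<And>n. \<exists>j. 2 * n < l j \<and> root_seq M (l j) \<le> L * root_seq M n"
    using base_index_beyond_double [OF weight assms(4) base(2) assms(6)] by blast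
  obtain T' where T': "\<And>n. real n / root_seq M n \<le> T'"
    using assms(7) unfolding bdd_above_def by blast
  define T where "T = max 1 T'"
  have T0: "0 < T"
    by (simp add: T_def)
  note pos = root_seq_pos [OF weight]
  have T: "real n \<le> T * root_seq M n" for n
  proof -
    have "real n / root_seq M n \<le> T"
      using T' [of n] by (simp add: T_def)
    then show ?thesis
      using pos [of n] by (simp add: pos_divide_le_eq)
  qed
  have "GS_bound M ((2 * K) * \<rho>) ((exp 3 * L) * \<sigma>) f"
    if C: "0 < C" and rho: "0 < \<rho>" and sigma: "0 < \<sigma>" and smooth: "smooth f"
      and lac: "lacunary_bound M k l C \<rho> \<sigma> f"
    for C \<rho> \<sigma> and f :: "real ^ 'n \<Rightarrow> complex"
  proof -
    define h where "h = T / \<sigma>"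
    define H where "H = real CARD('n) * h"
    have H: "0 < H"
      using T0 sigma by (simp add: H_def h_def)
    define E where "E = exp (2 * H * T / \<rho>)"
    have E: "1 \<le> E"
      using H T0 rho by (simp add: E_def)
    have absorb: "(2 * H) ^ a \<le> E * (\<rho> * root_seq M a) ^ a" for a
    proof -
      have "(2 * H) ^ a = ((2 * H * T / \<rho>) * (\<rho> / T)) ^ a"
        using T0 rho by simp
      also have "\<dots> = (2 * H * T / \<rho>) ^ a * (\<rho> / T) ^ a"
        by (rule power_mult_distrib)
      also have "\<dots> \<le> (fact a * E) * (\<rho> / T) ^ a"
        unfolding E_def using H T0 rho by (intro mult_right_mono power_le_fact_exp) auto
      also have "\<dots> \<le> (real a ^ a * E) * (\<rho> / T) ^ a"
        using fact_le_power [of a, where ?'a = real] T0 rho E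
        by (intro mult_right_mono) auto
      also have "\<dots> = E * (real a * (\<rho> / T)) ^ a"
        by (simp only: power_mult_distrib mult_ac)
      also have "\<dots> \<le> E * (\<rho> * root_seq M a) ^ a"
        using T [of a] T0 rho E by (intro mult_left_mono power_mono) (auto simp: field_simps)
      finally show ?thesis .
    qed
    have bound: "norm (mi_power x \<alpha> *\<^sub>R mi_deriv \<beta> f x)
      \<le> 2 ^ CARD('n) * C * E * (((2 * K) * \<rho> * root_seq M (mi_size \<alpha>)) ^ mi_size \<alpha>
          * ((exp 3 * L) * \<sigma> * root_seq M (mi_size \<beta>)) ^ mi_size \<beta>)" for \<alpha> \<beta> x
    proof -
      define a where "a = mi_size \<alpha>"
      define b where "b = mi_size \<beta>"
      obtain i where i: "\<And>j. \<bar>x $ j\<bar> \<le> \<bar>x $ i\<bar>"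
      proof -
        have "Max (range (\<lambda>j. \<bar>x $ j\<bar>)) \<in> range (\<lambda>j. \<bar>x $ j\<bar>)"
          by (intro Max_in) auto
        then obtain i where i: "Max (range (\<lambda>j. \<bar>x $ j\<bar>)) = \<bar>x $ i\<bar>"
          by (rule imageE)
        show thesis
          by (rule that [of i]) (simp add: i [symmetric])
      qed
      \<comment> \<open>\<open>r\<close> is the maximum norm of \<open>x\<close>.\<close>
      define r where "r = \<bar>x $ i\<bar>"
      obtain jk where jk: "2 * a < k jk" "root_seq M (k jk) \<le> K * root_seq M a"
        using K(2) by blast
      obtain jl where jl: "2 * b < l jl" "root_seq M (l jl) \<le> L * root_seq M b"
        using L(2) by blast
      define N where "N = l jl"
      define R where "R = \<sigma> * root_seq M N"
      have R: "0 < R"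
        using sigma pos by (simp add: R_def)
      have R_le: "R \<le> \<sigma> * (L * root_seq M b)"
        using jl(2) sigma by (simp add: R_def N_def)
      have "real N / R \<le> h"
        using T [of N] sigma pos [of N] by (simp add: R_def h_def field_simps)
      have top: "norm (mi_deriv \<gamma> f y) \<le> C * R ^ N" if "mi_size \<gamma> = N" for \<gamma> y
        using lac that unfolding lacunary_bound_def R_def N_def by blast
      have "\<exists>\<epsilon>. 0 < \<epsilon> \<and> \<epsilon> \<le> C \<and> (\<forall>y. (\<forall>j. \<bar>y $ j - x $ j\<bar> \<le> H) \<longrightarrow> norm (f y) \<le> \<epsilon>) \<and>
          sqrt (\<epsilon> * C) * r ^ a \<le> C * E * (2 * K * \<rho> * root_seq M a) ^ a"
      proof (cases "r < 2 * H")
        case True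
        have "r ^ a \<le> (2 * H) ^ a"
          using True by (intro power_mono) (auto simp: r_def)
        also have "\<dots> \<le> E * (\<rho> * root_seq M a) ^ a"
          by (rule absorb)
        also have "\<dots> \<le> E * (2 * K * (\<rho> * root_seq M a)) ^ a"
          using E K(1) rho pos [of a] by (intro mult_left_mono power_mono) auto
        finally have "C * r ^ a \<le> C * (E * (2 * K * (\<rho> * root_seq M a)) ^ a)"
          using C by (intro mult_left_mono) auto
        then show ?thesis
          using C lacunary_bound_imp_bounded [OF lac base(1)]
          by (intro exI [of _ C]) (auto simp: mult.assoc)
      next
        case False
        then have r: "0 < r"
          using H by simp
        define A where "A = 2 * (\<rho> * root_seq M (k jk))"
        have A: "0 < A"
          using rho pos by (simp add: A_def)
        \<comment> \<open>The minimum with \<open>1\<close> keeps \<open>\<epsilon> \<le> C\<close>, as interpolation demands; both bounds hold on the cube.\<close>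
        define \<epsilon> where "\<epsilon> = C * min 1 ((A / r) ^ (2 * a))"
        have "norm (f y) \<le> \<epsilon>" if "\<forall>j. \<bar>y $ j - x $ j\<bar> \<le> H" for y
        proof -
          \<comment> \<open>The coordinate that is largest at \<open>x\<close> stays comparable to \<open>r\<close> throughout the cube.\<close>
          have "r / 2 \<le> \<bar>y $ i\<bar>"
            using that [rule_format, of i] False by (simp add: r_def)
          then have "norm (f y) * (r / 2) ^ (2 * a) \<le> norm (f y) * \<bar>y $ i\<bar> ^ (2 * a)"
            using r by (intro mult_left_mono power_mono) auto
          also have "\<dots> \<le> C * (\<rho> * root_seq M (k jk)) ^ (2 * a)"
            using rho pos [of "k jk"] jk(1)
            by (intro lacunary_bound_decay [OF lac base(1)]) auto
          finally have "norm (f y) \<le> C * (\<rho> * root_seq M (k jk)) ^ (2 * a) / (r / 2) ^ (2 * a)"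
            using r by (simp add: pos_le_divide_eq)
          also have "\<dots> = C * (A / r) ^ (2 * a)"
            by (simp add: A_def power_divide power_mult_distrib)
          finally show ?thesis
            using lacunary_bound_imp_bounded [OF lac base(1), of y] C
            by (simp add: \<epsilon>_def min_def)
        qed
        moreover have "0 < \<epsilon>" "\<epsilon> \<le> C"
          using C A r by (auto simp: \<epsilon>_def mult_le_cancel_left1)
        moreover have "sqrt (\<epsilon> * C) * r ^ a \<le> C * E * (2 * K * \<rho> * root_seq M a) ^ a"
        proof -
          have "\<epsilon> * C \<le> C * (A / r) ^ (2 * a) * C"
            unfolding \<epsilon>_def using C by (intro mult_right_mono mult_left_mono) auto
          also have "\<dots> = (C * (A / r) ^ a)\<^sup>2"
            by (simp add: power2_eq_square power_add mult_2)
          finally have "sqrt (\<epsilon> * C) \<le> C * (A / r) ^ a"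
            using C A r by (intro real_le_lsqrt) auto
          then have "sqrt (\<epsilon> * C) * r ^ a \<le> C * (A / r) ^ a * r ^ a"
            using r by (intro mult_right_mono) auto
          also have "\<dots> = C * 1 * A ^ a"
            using r by (simp add: power_divide)
          also have "\<dots> \<le> C * E * (2 * (\<rho> * (K * root_seq M a))) ^ a"
            unfolding A_def using C E jk(2) rho pos
            by (intro mult_mono power_mono) (auto simp: less_imp_le)
          finally show ?thesis
            by (simp add: mult_ac)
        qed
        ultimately show ?thesis
          by blast
      qed
      then obtain \<epsilon> where eps: "0 < \<epsilon>" "\<epsilon> \<le> C"
        "\<And>y. (\<And>j. \<bar>y $ j - x $ j\<bar> \<le> H) \<Longrightarrow> norm (f y) \<le> \<epsilon>"
        "sqrt (\<epsilon> * C) * r ^ a \<le> C * E * (2 * K * \<rho> * root_seq M a) ^ a"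
        by blast
      have deriv: "norm (mi_deriv \<beta> f x) \<le> 2 ^ CARD('n) * sqrt (\<epsilon> * C) * (exp 3 * R) ^ mi_size \<beta>"
      proof (rule mi_deriv_interpolation [OF smooth R \<open>real N / R \<le> h\<close> eps(1,2)])
        show "norm (f y) \<le> \<epsilon>" if "\<And>j. \<bar>y $ j - x $ j\<bar> \<le> real CARD('n) * h" for y
          using that unfolding H_def [symmetric] by (rule eps(3))
        show "2 * mi_size \<beta> \<le> N" "0 < N"
          using jl(1) by (auto simp: N_def b_def)
      qed (rule top)
      have power: "(exp 3 * R) ^ b \<le> (exp 3 * (\<sigma> * (L * root_seq M b))) ^ b"
        using R R_le by (intro power_mono mult_left_mono) auto
      have "norm (mi_power x \<alpha> *\<^sub>R mi_deriv \<beta> f x) \<le> r ^ a * norm (mi_deriv \<beta> f x)"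
        unfolding norm_scaleR a_def r_def by (intro mult_right_mono abs_mi_power_le i) auto
      also have "\<dots> \<le> r ^ a * (2 ^ CARD('n) * sqrt (\<epsilon> * C) * (exp 3 * R) ^ b)"
        unfolding b_def by (intro mult_left_mono deriv) (simp add: r_def)
      also have "\<dots> = 2 ^ CARD('n) * ((sqrt (\<epsilon> * C) * r ^ a) * (exp 3 * R) ^ b)"
        by simp
      also have "\<dots> \<le> 2 ^ CARD('n) * ((C * E * (2 * K * \<rho> * root_seq M a) ^ a)
          * (exp 3 * (\<sigma> * (L * root_seq M b))) ^ b)"
        using C E R K(1) rho pos [of a]
        by (intro mult_left_mono [OF mult_mono [OF eps(4) power]]) auto
      finally show ?thesis
        by (simp add: a_def b_def mult_ac)
    qed
    show ?thesis
      unfolding GS_bound_def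
    proof (rule bdd_aboveI2 [where M = "2 ^ CARD('n) * C * E"], safe)
      fix \<alpha> \<beta> x
      show "norm (mi_power x \<alpha> *\<^sub>R mi_deriv \<beta> f x) /
          ((2 * K * \<rho> * root_seq M (mi_size \<alpha>)) ^ mi_size \<alpha> *
           (exp 3 * L * \<sigma> * root_seq M (mi_size \<beta>)) ^ mi_size \<beta>) \<le> 2 ^ CARD('n) * C * E"
        using bound [of x \<alpha> \<beta>] K(1) L(1) rho sigma pos
        by (subst pos_divide_le_eq) (auto simp: mult_ac)
    qed
  qed
  then show ?thesis
    using K(1) L(1) by (intro exI [of _ "2 * K"] exI [of _ "exp 3 * L"] conjI allI impI) auto
qed

lemma GS_bound_imp_lacunary_bound:
  assumes "weight_sequence M" and "0 < \<rho>" and "0 < \<sigma>" and "GS_bound M \<rho> \<sigma> f"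
  shows "\<exists>C>0. lacunary_bound M k l C \<rho> \<sigma> f"
proof -
  obtain B where B: "norm (mi_power x \<alpha> *\<^sub>R mi_deriv \<beta> f x) /
      ((\<rho> * root_seq M (mi_size \<alpha>)) ^ mi_size \<alpha> * (\<sigma> * root_seq M (mi_size \<beta>)) ^ mi_size \<beta>) \<le> B"
    for \<alpha> \<beta> x
    using assms(4) unfolding GS_bound_def bdd_above_def by auto
  define C where "C = max 1 B"
  have pos: "0 < \<rho> * root_seq M n" "0 < \<sigma> * root_seq M n" for n
    using assms root_seq_pos by auto
  have C: "norm (mi_power x \<alpha> *\<^sub>R mi_deriv \<beta> f x)
      \<le> C * ((\<rho> * root_seq M (mi_size \<alpha>)) ^ mi_size \<alpha> * (\<sigma> * root_seq M (mi_size \<beta>)) ^ mi_size \<beta>)"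
    for \<alpha> \<beta> x
    using B [of x \<alpha> \<beta>] pos by (subst pos_divide_le_eq [symmetric]) (auto simp: C_def)
  have "norm (mi_power x \<alpha> *\<^sub>R f x) \<le> C * (\<rho> * root_seq M (mi_size \<alpha>)) ^ mi_size \<alpha>" for \<alpha> x
    using C [of x \<alpha> "\<lambda>_. 0"] by (simp add: mi_size_zero mi_deriv_zero)
  moreover have "norm (mi_deriv \<beta> f x) \<le> C * (\<sigma> * root_seq M (mi_size \<beta>)) ^ mi_size \<beta>" for \<beta> x
    using C [of x "\<lambda>_. 0" \<beta>] by (simp add: mi_size_zero mi_power_zero)
  ultimately have "lacunary_bound M k l C \<rho> \<sigma> f"
    unfolding lacunary_bound_def by metis
  then show ?thesis
    by (intro exI [of _ C]) (simp add: C_def)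
qed

theorem theorem4p3:
  fixes k l :: "nat \<Rightarrow> nat" and M :: "nat \<Rightarrow> real"
  assumes "base_sequence k" and "base_sequence l"
    and "weight_sequence M" and "moderate_growth M"
    and "bdd_above (range (\<lambda>j. root_seq M (k (j + 1)) / root_seq M (k j)))"
    and "bdd_above (range (\<lambda>j. root_seq M (l (j + 1)) / root_seq M (l j)))"
  shows "(bdd_above (range (\<lambda>j. real j / root_seq M j)) \<longrightarrow>
            lacunary_GS_Roumieu M k l = (GS_Roumieu M :: (real ^ 'n::finite \<Rightarrow> complex) set)) \<and>
         ((\<lambda>j. real j / root_seq M j) \<longlonglongrightarrow> 0 \<longrightarrow>
            lacunary_GS_Beurling M k l = (GS_Beurling M :: (real ^ 'n \<Rightarrow> complex) set))"
proof -
  have both: "lacunary_GS_Roumieu M k l = (GS_Roumieu M :: (real ^ 'n \<Rightarrow> complex) set)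
      \<and> lacunary_GS_Beurling M k l = (GS_Beurling M :: (real ^ 'n \<Rightarrow> complex) set)"
    if bdd: "bdd_above (range (\<lambda>j. real j / root_seq M j))"
  proof -
    obtain A B where AB: "0 < A" "0 < B"
      and GS: "\<forall>C>0. \<forall>\<rho>>0. \<forall>\<sigma>>0. \<forall>f :: real ^ 'n \<Rightarrow> complex.
        smooth f \<longrightarrow> lacunary_bound M k l C \<rho> \<sigma> f \<longrightarrow> GS_bound M (A * \<rho>) (B * \<sigma>) f"
      using lacunary_bound_imp_GS_bound [OF assms bdd, where ?'n = 'n] by (elim exE conjE)
    note converse = GS_bound_imp_lacunary_bound [OF assms(3), of _ _ _ k l]
    have "f \<in> lacunary_GS_Roumieu M k l \<longleftrightarrow> f \<in> GS_Roumieu M" for f :: "real ^ 'n \<Rightarrow> complex"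
    proof
      assume "f \<in> lacunary_GS_Roumieu M k l"
      then obtain C \<rho> \<sigma> where *: "smooth f" "0 < C" "0 < \<rho>" "0 < \<sigma>" "lacunary_bound M k l C \<rho> \<sigma> f"
        by (auto simp: lacunary_GS_Roumieu_def)
      then have "GS_bound M (A * \<rho>) (B * \<sigma>) f" "0 < A * \<rho>" "0 < B * \<sigma>"
        using GS AB by auto
      then show "f \<in> GS_Roumieu M"
        using *(1) by (auto simp: GS_Roumieu_def)
    next
      assume "f \<in> GS_Roumieu M"
      then show "f \<in> lacunary_GS_Roumieu M k l"
        unfolding GS_Roumieu_def lacunary_GS_Roumieu_def using converse by blast
    qed
    moreover have "f \<in> lacunary_GS_Beurling M k l \<longleftrightarrow> f \<in> GS_Beurling M"
      for f :: "real ^ 'n \<Rightarrow> complex"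
    proof
      assume f: "f \<in> lacunary_GS_Beurling M k l"
      have "GS_bound M \<rho> \<sigma> f" if "0 < \<rho>" "0 < \<sigma>" for \<rho> \<sigma>
      proof -
        have "0 < \<rho> / A" "0 < \<sigma> / B"
          using that AB(1,2) by auto
        then obtain C where "0 < C" "lacunary_bound M k l C (\<rho> / A) (\<sigma> / B) f"
          using f unfolding lacunary_GS_Beurling_def by blast
        then have "GS_bound M (A * (\<rho> / A)) (B * (\<sigma> / B)) f"
          using GS f \<open>0 < \<rho> / A\<close> \<open>0 < \<sigma> / B\<close> unfolding lacunary_GS_Beurling_def by blast
        then show ?thesis
          using AB(1,2) by simp
      qed
      then show "f \<in> GS_Beurling M"
        using f by (simp add: GS_Beurling_def lacunary_GS_Beurling_def)
    next
      assume "f \<in> GS_Beurling M"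
      then show "f \<in> lacunary_GS_Beurling M k l"
        unfolding GS_Beurling_def lacunary_GS_Beurling_def using converse by blast
    qed
    ultimately show ?thesis
      by blast
  qed
  have bdd: "bdd_above (range (\<lambda>j. real j / root_seq M j))"
    if "(\<lambda>j. real j / root_seq M j) \<longlonglongrightarrow> 0"
    using that by (intro Bseq_bdd_above convergent_imp_Bseq convergentI)
  show ?thesis
    by (intro conjI impI) (erule both [THEN conjunct1], erule both [OF bdd, THEN conjunct2])
qed

end
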